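(* Let $\theta\in(0,1]$, $r>0$, $s>0$ satisfy $rs<1/\|\mathcal{L}\mathcal{L}^*\|$, and let $\rho,\sigma$ satisfy: $\rho=\sigma\in(0,2)$ if $\theta=1$; and $\rho\in(0,1+\theta-\sqrt{1-\theta}\,]$, $\sigma=\rho/\theta$ if $\theta\in(0,1)$. Let $\{w^k=(u_0^k,p^k)^\top\}$ and $\{\widetilde w^k=(\widetilde u_0^k,\widetilde p^{\,k})^\top\}$ be the sequences generated, from arbitrary initial value $w^0=(u_0^0,p^0)^\top\in L^2(\Omega)\times L^2(\Omega)$, by the generalized primal-dual algorithm (described in the context) with these parameters, and let $w^*=(u_0^*,p^* )^\top$ be the solution (saddle point) of $$\min_{u_0\in L^2(\Omega)}\max_{p\in L^2(\Omega)}\Big(g(u_0)+\int_\Omega p\,\mathcal{L}u_0\,dx-f^*(p)\Big).$$ For any $K\in\mathbb{N}$, define $$w_K=\frac1{K+1}\sum_{k=0}^K\widetilde w^k,\qquad u_{0,K}=\frac1{K+1}\sum_{k=0}^K\widetilde u_0^k.$$ Then $$\varphi(u_{0,K})-\varphi(u_0^* )+\big(w_K-w^*,F(w^* )\big)\le\frac1{2(K+1)}\|w^0-w^*\|_{\mathcal{K}}^2.$$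
   Context: Setting. $\Omega\subset\mathbb{R}^N$, $N\ge1$, is a bounded domain, $0<T<\infty$, $d>0$ is a constant, $v\in\mathbb{R}^N$ is a constant vector, $u_T\in L^2(\Omega)$ is given, and $\tau>0$, $\beta>0$ are constants. $\mathcal{L}:L^2(\Omega)\to L^2(\Omega)$ is the (bounded linear) solution operator $\mathcal{L}u_0=u(\cdot,T)$ of $$\partial_t u-d\Delta u+v\cdot\nabla u=0\ \text{in }\Omega\times(0,T),\quad u=0\ \text{on }\partial\Omega\times(0,T),\quad u(\cdot,0)=u_0,$$ and $\mathcal{L}^*$ is its adjoint. $\|\mathcal{L}\mathcal{L}^*\|$ is the operator norm. Functionals. $\varphi(u_0)=\beta\int_\Omega|u_0|dx$, $g(u_0)=\frac{\tau}{2}\int_\Omega|u_0|^2dx+\varphi(u_0)$, and $f^*(p)=\frac12\int_\Omega|p|^2dx+\int_\Omega p\,u_T\,dx$ (the convex conjugate of $f(q)=\frac12\int_\Omega|q-u_T|^2dx$). Generalized primal-dual algorithm. Given $(u_0^0,p^0)\in L^2(\Omega)\times L^2(\Omega)$, for $k=0,1,2,\dots$ compute $$\widetilde u_0^k=\arg\min_{u_0\in L^2(\Omega)}\Big(g(u_0)+\int_\Omega p^k\mathcal{L}u_0\,dx+\tfrac1{2r}\|u_0-u_0^k\|^2_{L^2(\Omega)}\Big),$$ $$\bar u_0^k=\widetilde u_0^k+\theta(\widetilde u_0^k-u_0^k),$$ $$\widetilde p^{\,k}=\arg\max_{p\in L^2(\Omega)}\Big(\int_\Omega p\,\mathcal{L}\bar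 u_0^k\,dx-f^*(p)-\tfrac1{2s}\|p-p^k\|^2_{L^2(\Omega)}\Big),$$ $$u_0^{k+1}=u_0^k-\rho(u_0^k-\widetilde u_0^k),\qquad p^{k+1}=p^k-\sigma(p^k-\widetilde p^{\,k}).$$ Notation. $W=L^2(\Omega)\times L^2(\Omega)$ with its canonical inner product $(\cdot,\cdot)$; for $w=(u_0,p)^\top\in W$, $$F(w)=\begin{pmatrix}\tau u_0+\mathcal{L}^*p\\ p-\mathcal{L}u_0+u_T\end{pmatrix}.$$ Define operators on $W$ by $$\mathcal{D}=\begin{pmatrix}\rho I&0\\0&\sigma I\end{pmatrix},\quad G=\begin{pmatrix}\frac1rI&-\mathcal{L}^*\\-\theta\mathcal{L}&\frac1sI\end{pmatrix},\quad \mathcal{K}=G\mathcal{D}^{-1}.$$ Under the stated parameter conditions $\mathcal{K}$ is self-adjoint and positive definite, and $\|w\|_{\mathcal{K}}^2:=(\mathcal{K}w,w)$. *)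

theory Defs
  imports "HOL-Analysis.Analysis" "HOL-Library.Function_Algebras"
begin

section \<open>The space of square integrable functions\<close>

text \<open>
  Elements of \<open>L\<^sup>2(\<Omega>)\<close> are represented by functions on the whole space of which only the
  restriction to \<open>\<Omega>\<close> matters, and equality in \<open>L\<^sup>2(\<Omega>)\<close> is equality almost everywhere
  on \<open>\<Omega>\<close>.
\<close>

definition L2 :: "'a::euclidean_space set \<Rightarrow> ('a \<Rightarrow> 'b::euclidean_space) set" where
  "L2 \<Omega> = {f \<in> borel_measurable (lebesgue_on \<Omega>).
             integrable (lebesgue_on \<Omega>) (\<lambda>x. (norm (f x))\<^sup>2)}"

definition L2_eq :: "'a::euclidean_space set \<Rightarrow> ('a \<Rightarrow> 'b) \<Rightarrow> ('a \<Rightarrow> 'b) \<Rightarrow> bool" where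
  "L2_eq \<Omega> f g \<longleftrightarrow> (AE x in lebesgue_on \<Omega>. f x = g x)"

definition L2_inner ::
    "'a::euclidean_space set \<Rightarrow> ('a \<Rightarrow> 'b::euclidean_space) \<Rightarrow> ('a \<Rightarrow> 'b) \<Rightarrow> real" where
  "L2_inner \<Omega> f g = (LINT x|lebesgue_on \<Omega>. f x \<bullet> g x)"

definition L2_norm :: "'a::euclidean_space set \<Rightarrow> ('a \<Rightarrow> 'b::euclidean_space) \<Rightarrow> real" where
  "L2_norm \<Omega> f = sqrt (L2_inner \<Omega> f f)"

definition fscale :: "real \<Rightarrow> ('a \<Rightarrow> 'b::real_vector) \<Rightarrow> 'a \<Rightarrow> 'b"  (infixr "*\<^sub>F" 75) where
  "c *\<^sub>F f = (\<lambda>x. c *\<^sub>R f x)"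

definition L2_bounded_linear ::
    "'a::euclidean_space set \<Rightarrow> (('a \<Rightarrow> real) \<Rightarrow> ('a \<Rightarrow> real)) \<Rightarrow> bool" where
  "L2_bounded_linear \<Omega> A \<longleftrightarrow>
     (\<forall>f\<in>L2 \<Omega>. A f \<in> L2 \<Omega>) \<and>
     (\<forall>f\<in>L2 \<Omega>. \<forall>g\<in>L2 \<Omega>. L2_eq \<Omega> (A (f + g)) (A f + A g)) \<and>
     (\<forall>c. \<forall>f\<in>L2 \<Omega>. L2_eq \<Omega> (A (c *\<^sub>F f)) (c *\<^sub>F A f)) \<and>
     (\<exists>C. \<forall>f\<in>L2 \<Omega>. L2_norm \<Omega> (A f) \<le> C * L2_norm \<Omega> f)"

text \<open>The counterpart of \<^const>\<open>onorm\<close>; functions of norm zero contribute \<open>0 / 0 = 0\<close>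
  (for bounded linear \<open>A\<close> also the numerator vanishes there).\<close>

definition L2_onorm ::
    "'a::euclidean_space set \<Rightarrow> (('a \<Rightarrow> real) \<Rightarrow> ('a \<Rightarrow> real)) \<Rightarrow> real" where
  "L2_onorm \<Omega> A = (SUP f\<in>L2 \<Omega>. L2_norm \<Omega> (A f) / L2_norm \<Omega> f)"

definition L2_adjoint ::
    "'a::euclidean_space set \<Rightarrow> (('a \<Rightarrow> real) \<Rightarrow> ('a \<Rightarrow> real)) \<Rightarrow> (('a \<Rightarrow> real) \<Rightarrow> ('a \<Rightarrow> real)) \<Rightarrow> bool"
  where
  "L2_adjoint \<Omega> A A' \<longleftrightarrow>
     (\<forall>g\<in>L2 \<Omega>. A' g \<in> L2 \<Omega>) \<and>
     (\<forall>f\<in>L2 \<Omega>. \<forall>g\<in>L2 \<Omega>. L2_inner \<Omega> (A f) g = L2_inner \<Omega> f (A' g))"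


section \<open>The advection-diffusion equation with homogeneous Dirichlet condition\<close>

definition grad :: "(real^'n \<Rightarrow> real) \<Rightarrow> real^'n \<Rightarrow> real^'n" where
  "grad f x = (\<chi> i. frechet_derivative f (at x) (axis i 1))"

primrec Ck :: "nat \<Rightarrow> (real^'n \<Rightarrow> real) \<Rightarrow> bool" where
  "Ck 0 f \<longleftrightarrow> continuous_on UNIV f"
| "Ck (Suc k) f \<longleftrightarrow> f differentiable_on UNIV \<and> (\<forall>i. Ck k (\<lambda>x. grad f x $ i))"

definition test_functions :: "(real^'n) set \<Rightarrow> (real^'n \<Rightarrow> real) set" where
  "test_functions \<Omega> =
     {\<psi>. (\<forall>k. Ck k \<psi>) \<and> compact (closure {x. \<psi> x \<noteq> 0}) \<and> closure {x. \<psi> x \<noteq> 0} \<subseteq> \<Omega>}"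

definition weak_gradient :: "(real^'n) set \<Rightarrow> (real^'n \<Rightarrow> real) \<Rightarrow> (real^'n \<Rightarrow> real^'n) \<Rightarrow> bool" where
  "weak_gradient \<Omega> u Du \<longleftrightarrow>
     (\<forall>\<psi>\<in>test_functions \<Omega>. \<forall>i.
        (LINT x|lebesgue_on \<Omega>. u x * grad \<psi> x $ i) = - (LINT x|lebesgue_on \<Omega>. Du x $ i * \<psi> x))"

text \<open>\<open>u \<in> H\<^sub>0\<^sup>1(\<Omega>)\<close> with weak gradient \<open>Du\<close>, where \<open>H\<^sub>0\<^sup>1(\<Omega>)\<close> is the closure of the test
  functions in \<open>H\<^sup>1(\<Omega>)\<close>.\<close>

definition H10 :: "(real^'n) set \<Rightarrow> (real^'n \<Rightarrow> real) \<Rightarrow> (real^'n \<Rightarrow> real^'n) \<Rightarrow> bool" where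
  "H10 \<Omega> u Du \<longleftrightarrow>
     u \<in> L2 \<Omega> \<and> Du \<in> L2 \<Omega> \<and> weak_gradient \<Omega> u Du \<and>
     (\<exists>\<psi>. (\<forall>n::nat. \<psi> n \<in> test_functions \<Omega>) \<and>
          (\<lambda>n. L2_norm \<Omega> (\<psi> n - u)) \<longlonglongrightarrow> 0 \<and>
          (\<lambda>n. L2_norm \<Omega> (grad (\<psi> n) - Du)) \<longlonglongrightarrow> 0)"

text \<open>
  Weak solutions \<open>u \<in> C([0,T]; L\<^sup>2(\<Omega>)) \<inter> L\<^sup>2(0,T; H\<^sub>0\<^sup>1(\<Omega>))\<close> of
  \<open>\<partial>\<^sub>t u - d \<Delta> u + v \<cdot> \<nabla>u = 0\<close>, \<open>u = 0\<close> on the boundary, \<open>u(0) = u\<^sub>0\<close>.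
  The equation is tested with \<open>\<psi>\<close> and integrated over \<open>(0,t)\<close>, which is the integrated form of
  \<open>\<langle>\<partial>\<^sub>t u, \<psi>\<rangle> + d (\<nabla>u, \<nabla>\<psi>) + (v \<cdot> \<nabla>u, \<psi>) = 0\<close>; \<open>Du\<close> is the spatial gradient.
\<close>

definition weak_solution ::
    "(real^'n) set \<Rightarrow> real \<Rightarrow> real \<Rightarrow> real^'n \<Rightarrow> (real^'n \<Rightarrow> real) \<Rightarrow> (real \<Rightarrow> real^'n \<Rightarrow> real) \<Rightarrow> bool"
  where
  "weak_solution \<Omega> T d v u0 u \<longleftrightarrow>
     (\<forall>t\<in>{0..T}. u t \<in> L2 \<Omega>) \<and>
     (\<forall>t\<in>{0..T}. ((\<lambda>t'. L2_norm \<Omega> (u t' - u t)) \<longlongrightarrow> 0) (at t within {0..T})) \<and>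
     L2_eq \<Omega> (u 0) u0 \<and>
     (\<exists>Du.
        (\<lambda>(t, x). u t x) \<in> L2 ({0<..<T} \<times> \<Omega>) \<and>
        (\<lambda>(t, x). Du t x) \<in> L2 ({0<..<T} \<times> \<Omega>) \<and>
        (AE t in lebesgue_on {0<..<T}. H10 \<Omega> (u t) (Du t)) \<and>
        (\<forall>\<psi>\<in>test_functions \<Omega>. \<forall>t\<in>{0..T}.
           L2_inner \<Omega> (u t) \<psi> - L2_inner \<Omega> u0 \<psi>
             + (LINT (t', x)|lebesgue_on ({0<..<t} \<times> \<Omega>).
                  d * (Du t' x \<bullet> grad \<psi> x) + (v \<bullet> Du t' x) * \<psi> x) = 0))"

definition solution_operator ::
    "(real^'n) set \<Rightarrow> real \<Rightarrow> real \<Rightarrow> real^'n \<Rightarrow> ((real^'n \<Rightarrow> real) \<Rightarrow> (real^'n \<Rightarrow> real)) \<Rightarrow> bool" where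
  "solution_operator \<Omega> T d v L \<longleftrightarrow>
     (\<forall>u0\<in>L2 \<Omega>. \<exists>u. weak_solution \<Omega> T d v u0 u \<and> L2_eq \<Omega> (L u0) (u T))"


section \<open>The saddle point problem and the generalized primal-dual algorithm\<close>

definition phi :: "'a::euclidean_space set \<Rightarrow> real \<Rightarrow> ('a \<Rightarrow> real) \<Rightarrow> real" where
  "phi \<Omega> \<beta> u = \<beta> * (LINT x|lebesgue_on \<Omega>. \<bar>u x\<bar>)"

definition g_fun :: "'a::euclidean_space set \<Rightarrow> real \<Rightarrow> real \<Rightarrow> ('a \<Rightarrow> real) \<Rightarrow> real" where
  "g_fun \<Omega> \<tau> \<beta> u = \<tau> / 2 * (LINT x|lebesgue_on \<Omega>. \<bar>u x\<bar>\<^sup>2) + phi \<Omega> \<beta> u"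

definition f_conj :: "'a::euclidean_space set \<Rightarrow> ('a \<Rightarrow> real) \<Rightarrow> ('a \<Rightarrow> real) \<Rightarrow> real" where
  "f_conj \<Omega> uT p =
     1 / 2 * (LINT x|lebesgue_on \<Omega>. \<bar>p x\<bar>\<^sup>2) + (LINT x|lebesgue_on \<Omega>. p x * uT x)"

definition saddle_point ::
    "'a::euclidean_space set \<Rightarrow> (('a \<Rightarrow> real) \<Rightarrow> ('a \<Rightarrow> real)) \<Rightarrow> ('a \<Rightarrow> real) \<Rightarrow> real \<Rightarrow> real \<Rightarrow>
     ('a \<Rightarrow> real) \<Rightarrow> ('a \<Rightarrow> real) \<Rightarrow> bool" where
  "saddle_point \<Omega> L uT \<tau> \<beta> u p \<longleftrightarrow>
     (let \<Phi> = (\<lambda>u p. g_fun \<Omega> \<tau> \<beta> u + (LINT x|lebesgue_on \<Omega>. p x * L u x) - f_conj \<Omega> uT p)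
      in u \<in> L2 \<Omega> \<and> p \<in> L2 \<Omega> \<and>
         (\<forall>q\<in>L2 \<Omega>. \<Phi> u q \<le> \<Phi> u p) \<and> (\<forall>w\<in>L2 \<Omega>. \<Phi> u p \<le> \<Phi> w p))"

definition gpd_iterates ::
    "'a::euclidean_space set \<Rightarrow> (('a \<Rightarrow> real) \<Rightarrow> ('a \<Rightarrow> real)) \<Rightarrow> ('a \<Rightarrow> real) \<Rightarrow> real \<Rightarrow> real \<Rightarrow>
     real \<Rightarrow> real \<Rightarrow> real \<Rightarrow> real \<Rightarrow> real \<Rightarrow>
     (nat \<Rightarrow> 'a \<Rightarrow> real) \<Rightarrow> (nat \<Rightarrow> 'a \<Rightarrow> real) \<Rightarrow> (nat \<Rightarrow> 'a \<Rightarrow> real) \<Rightarrow> (nat \<Rightarrow> 'a \<Rightarrow> real) \<Rightarrow> bool"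
  where
  "gpd_iterates \<Omega> L uT \<tau> \<beta> r s \<theta> \<rho> \<sigma> u p ut pt \<longleftrightarrow>
     u 0 \<in> L2 \<Omega> \<and> p 0 \<in> L2 \<Omega> \<and>
     (\<forall>k.
        is_arg_min
          (\<lambda>w. g_fun \<Omega> \<tau> \<beta> w + (LINT x|lebesgue_on \<Omega>. p k x * L w x)
                 + 1 / (2 * r) * (L2_norm \<Omega> (w - u k))\<^sup>2)
          (\<lambda>w. w \<in> L2 \<Omega>) (ut k) \<and>
        is_arg_max
          (\<lambda>q. (LINT x|lebesgue_on \<Omega>. q x * L (ut k + \<theta> *\<^sub>F (ut k - u k)) x) - f_conj \<Omega> uT q
                 - 1 / (2 * s) * (L2_norm \<Omega> (q - p k))\<^sup>2)
          (\<lambda>q. q \<in> L2 \<Omega>) (pt k) \<and>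
        u (Suc k) \<in> L2 \<Omega> \<and> L2_eq \<Omega> (u (Suc k)) (u k - \<rho> *\<^sub>F (u k - ut k)) \<and>
        p (Suc k) \<in> L2 \<Omega> \<and> L2_eq \<Omega> (p (Suc k)) (p k - \<sigma> *\<^sub>F (p k - pt k)))"

definition ergodic_mean :: "(nat \<Rightarrow> 'a \<Rightarrow> real) \<Rightarrow> nat \<Rightarrow> 'a \<Rightarrow> real" where
  "ergodic_mean a K = (1 / (real K + 1)) *\<^sub>F (\<Sum>k=0..K. a k)"


section \<open>Operators on \<open>W = L\<^sup>2(\<Omega>) \<times> L\<^sup>2(\<Omega>)\<close>\<close>

type_synonym 'a W = "('a \<Rightarrow> real) \<times> ('a \<Rightarrow> real)"

definition W_inner :: "'a::euclidean_space set \<Rightarrow> 'a W \<Rightarrow> 'a W \<Rightarrow> real" where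
  "W_inner \<Omega> w z = L2_inner \<Omega> (fst w) (fst z) + L2_inner \<Omega> (snd w) (snd z)"

definition F_op ::
    "(('a \<Rightarrow> real) \<Rightarrow> ('a \<Rightarrow> real)) \<Rightarrow> (('a \<Rightarrow> real) \<Rightarrow> ('a \<Rightarrow> real)) \<Rightarrow> ('a \<Rightarrow> real) \<Rightarrow> real \<Rightarrow> 'a W \<Rightarrow> 'a W"
  where
  "F_op L L' uT \<tau> = (\<lambda>(u, p). (\<tau> *\<^sub>F u + L' p, p - L u + uT))"

definition D_op :: "real \<Rightarrow> real \<Rightarrow> 'a W \<Rightarrow> 'a W" where
  "D_op \<rho> \<sigma> = (\<lambda>(u, p). (\<rho> *\<^sub>F u, \<sigma> *\<^sub>F p))"

definition G_op ::
    "(('a \<Rightarrow> real) \<Rightarrow> ('a \<Rightarrow> real)) \<Rightarrow> (('a \<Rightarrow> real) \<Rightarrow> ('a \<Rightarrow> real)) \<Rightarrow> real \<Rightarrow> real \<Rightarrow> real \<Rightarrow> 'a W \<Rightarrow> 'a W"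
  where
  "G_op L L' r s \<theta> = (\<lambda>(u, p). ((1 / r) *\<^sub>F u - L' p, - (\<theta> *\<^sub>F L u) + (1 / s) *\<^sub>F p))"

definition K_op ::
    "(('a \<Rightarrow> real) \<Rightarrow> ('a \<Rightarrow> real)) \<Rightarrow> (('a \<Rightarrow> real) \<Rightarrow> ('a \<Rightarrow> real)) \<Rightarrow> real \<Rightarrow> real \<Rightarrow> real \<Rightarrow> real \<Rightarrow> real \<Rightarrow>
     'a W \<Rightarrow> 'a W"
  where
  "K_op L L' r s \<theta> \<rho> \<sigma> = G_op L L' r s \<theta> \<circ> inv (D_op \<rho> \<sigma>)"

definition K_normsq ::
    "'a::euclidean_space set \<Rightarrow> (('a \<Rightarrow> real) \<Rightarrow> ('a \<Rightarrow> real)) \<Rightarrow> (('a \<Rightarrow> real) \<Rightarrow> ('a \<Rightarrow> real)) \<Rightarrow>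
     real \<Rightarrow> real \<Rightarrow> real \<Rightarrow> real \<Rightarrow> real \<Rightarrow> 'a W \<Rightarrow> real"
  where
  "K_normsq \<Omega> L L' r s \<theta> \<rho> \<sigma> w = W_inner \<Omega> (K_op L L' r s \<theta> \<rho> \<sigma> w) w"

end

theory Submission
  imports Defs
begin

text \<open>
  Each of the two steps of the algorithm minimises the sum of a convex functional and a quadratic
  one, and is therefore equivalent to a variational inequality.  Write \<open>w = (u, p)\<close>, let
  \<open>\<parallel>\<cdot>\<parallel>\<^sub>K\<close> denote the norm of the operator \<open>K = G D\<inverse>\<close>, and let \<open>t\<^sub>k\<close> be the
  pair of predictors computed from \<open>w\<^sub>k\<close>.  The two variational inequalities together say
  that, for every \<open>w\<close>,
  \<open>\<phi>(u) - \<phi>(t\<^sub>k) + (w - t\<^sub>k, F(t\<^sub>k) + G (t\<^sub>k - w\<^sub>k)) \<ge> 0\<close>,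
  where \<open>\<phi>(t\<^sub>k)\<close> is taken at the first component.
  The part of \<open>F\<close> that involves \<open>L\<close> is skew and the rest is monotone, so \<open>F(t\<^sub>k)\<close> may
  be replaced by \<open>F(w)\<close>.  Since \<open>G (w\<^sub>k - t\<^sub>k) = K (w\<^sub>k - w\<^sub>k\<^sub>+\<^sub>1)\<close> and \<open>K\<close> is
  self-adjoint (this is what \<open>\<rho> = \<theta> \<sigma>\<close> achieves), the remaining inner product is half the
  decrease of \<open>\<parallel>w\<^sub>k - w\<parallel>\<^sub>K\<^sup>2\<close>, up to a quadratic form in \<open>w\<^sub>k - t\<^sub>k\<close>.

  For \<open>\<rho>, \<sigma> \<le> 2\<close> that form is nonnegative as soon as
  \<open>(1 + \<theta> - \<rho>)\<^sup>2 \<le> (2 - \<rho>) (2 - \<sigma>)\<close>, because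
  \<open>r s \<parallel>L L\<^sup>*\<parallel> < 1\<close>; and for \<open>\<sigma> = \<rho> / \<theta>\<close> with \<open>\<theta> < 1\<close> the condition reads
  \<open>1 - \<theta> \<le> (1 + \<theta> - \<rho>)\<^sup>2\<close>, which explains the upper bound on \<open>\<rho>\<close>
  (\<open>admissible_parameters\<close>, \<open>weighted_form_nonneg\<close>).  The resulting estimate for one
  iteration (\<open>one_iteration\<close>) is summed over the iterations: its right-hand side telescopes, the
  last term is dropped since the operator \<open>K\<close> is positive, and on the left-hand side
  convexity of \<open>\<phi>\<close> and linearity of the inner product allow passing to the ergodic mean (\<open>ergodic_rate\<close>).
\<close>

section \<open>The semi-inner product space of square integrable functions\<close>

lemma L2_real_iff:
  fixes f :: "'a::euclidean_space \<Rightarrow> real"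
  shows "f \<in> L2 \<Omega> \<longleftrightarrow> f \<in> borel_measurable (lebesgue_on \<Omega>) \<and> integrable (lebesgue_on \<Omega>) (\<lambda>x. (f x)\<^sup>2)"
  by (simp add: L2_def)

lemma L2_integrable_mult:
  fixes f g :: "'a::euclidean_space \<Rightarrow> real"
  assumes "f \<in> L2 \<Omega>" "g \<in> L2 \<Omega>"
  shows "integrable (lebesgue_on \<Omega>) (\<lambda>x. f x * g x)"
proof (rule Bochner_Integration.integrable_bound)
  show "integrable (lebesgue_on \<Omega>) (\<lambda>x. (f x)\<^sup>2 + (g x)\<^sup>2)"
    using assms by (auto simp: L2_real_iff)
  show "(\<lambda>x. f x * g x) \<in> borel_measurable (lebesgue_on \<Omega>)"
    using assms by (auto simp: L2_real_iff)
  have "\<bar>a * b\<bar> \<le> \<bar>a\<^sup>2 + b\<^sup>2\<bar>" for a b :: real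
  proof -
    have "2 * \<bar>a * b\<bar> \<le> a\<^sup>2 + b\<^sup>2"
      using sum_squares_bound[of "\<bar>a\<bar>" "\<bar>b\<bar>"] by (simp add: abs_mult)
    then show ?thesis by linarith
  qed
  then show "AE x in lebesgue_on \<Omega>. norm (f x * g x) \<le> norm ((f x)\<^sup>2 + (g x)\<^sup>2)"
    by (intro AE_I2) (simp only: real_norm_def)
qed

lemma L2_add [intro, simp]:
  fixes f g :: "'a::euclidean_space \<Rightarrow> real"
  assumes "f \<in> L2 \<Omega>" "g \<in> L2 \<Omega>"
  shows "f + g \<in> L2 \<Omega>"
proof -
  have "integrable (lebesgue_on \<Omega>) (\<lambda>x. (f x)\<^sup>2 + (g x)\<^sup>2 + 2 * (f x * g x))"
    using assms L2_integrable_mult[OF assms] by (auto simp: L2_real_iff)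
  then show ?thesis
    using assms by (auto simp: L2_real_iff plus_fun_def power2_sum mult.assoc)
qed

lemma L2_scale [intro, simp]:
  fixes f :: "'a::euclidean_space \<Rightarrow> real"
  assumes "f \<in> L2 \<Omega>"
  shows "c *\<^sub>F f \<in> L2 \<Omega>"
  using assms by (auto simp: L2_real_iff fscale_def power_mult_distrib)

lemma L2_diff [intro, simp]:
  fixes f g :: "'a::euclidean_space \<Rightarrow> real"
  assumes "f \<in> L2 \<Omega>" "g \<in> L2 \<Omega>"
  shows "f - g \<in> L2 \<Omega>"
proof -
  have "f - g = f + (-1) *\<^sub>F g"
    by (auto simp: fscale_def)
  then show ?thesis
    using assms by (metis L2_add L2_scale)
qed

lemma L2_minus [intro, simp]:
  fixes f :: "'a::euclidean_space \<Rightarrow> real"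
  assumes "f \<in> L2 \<Omega>"
  shows "- f \<in> L2 \<Omega>"
proof -
  have "- f = (-1) *\<^sub>F f"
    by (auto simp: fscale_def)
  then show ?thesis
    using assms by (metis L2_scale)
qed

lemma L2_inner_real: "L2_inner \<Omega> f g = (LINT x|lebesgue_on \<Omega>. f x * g x)"
  for f g :: "'a::euclidean_space \<Rightarrow> real"
  by (simp add: L2_inner_def)

lemma L2_inner_commute: "L2_inner \<Omega> f g = L2_inner \<Omega> g f"
  by (simp add: L2_inner_def inner_commute)

context
  fixes \<Omega> :: "'a::euclidean_space set" and f g h :: "'a \<Rightarrow> real"
  assumes L2: "f \<in> L2 \<Omega>" "g \<in> L2 \<Omega>" "h \<in> L2 \<Omega>"
begin

lemma L2_inner_add_left: "L2_inner \<Omega> (f + g) h = L2_inner \<Omega> f h + L2_inner \<Omega> g h"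
  using L2 by (simp add: L2_inner_real algebra_simps L2_integrable_mult)

lemma L2_inner_diff_left: "L2_inner \<Omega> (f - g) h = L2_inner \<Omega> f h - L2_inner \<Omega> g h"
  using L2 by (simp add: L2_inner_real algebra_simps L2_integrable_mult)

lemma L2_inner_add_right: "L2_inner \<Omega> h (f + g) = L2_inner \<Omega> h f + L2_inner \<Omega> h g"
  using L2 by (simp add: L2_inner_real algebra_simps L2_integrable_mult)

lemma L2_inner_diff_right: "L2_inner \<Omega> h (f - g) = L2_inner \<Omega> h f - L2_inner \<Omega> h g"
  using L2 by (simp add: L2_inner_real algebra_simps L2_integrable_mult)

end

lemma L2_inner_scale_left: "L2_inner \<Omega> (c *\<^sub>F f) g = c * L2_inner \<Omega> f g"
  for f g :: "'a::euclidean_space \<Rightarrow> real"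
  by (simp add: L2_inner_real fscale_def mult.assoc)

lemma L2_inner_scale_right: "L2_inner \<Omega> f (c *\<^sub>F g) = c * L2_inner \<Omega> f g"
  for f g :: "'a::euclidean_space \<Rightarrow> real"
  by (metis L2_inner_commute L2_inner_scale_left)

lemma L2_inner_minus_left: "L2_inner \<Omega> (- f) g = - L2_inner \<Omega> f g"
  for f g :: "'a::euclidean_space \<Rightarrow> real"
  by (simp add: L2_inner_real)

lemmas L2_inner_simps =
  L2_inner_add_left L2_inner_diff_left L2_inner_add_right L2_inner_diff_right
  L2_inner_scale_left L2_inner_scale_right L2_inner_minus_left

lemma L2_inner_nonneg: "0 \<le> L2_inner \<Omega> f f"
  by (simp add: L2_inner_def)

lemma L2_norm_square: "(L2_norm \<Omega> f)\<^sup>2 = L2_inner \<Omega> f f"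
  by (simp add: L2_norm_def L2_inner_nonneg)

lemma L2_norm_nonneg [simp]: "0 \<le> L2_norm \<Omega> f"
  by (simp add: L2_norm_def L2_inner_nonneg)

lemma L2_inner_eq_left:
  fixes f g h :: "'a::euclidean_space \<Rightarrow> real"
  assumes "L2_eq \<Omega> f g" "f \<in> L2 \<Omega>" "g \<in> L2 \<Omega>" "h \<in> L2 \<Omega>"
  shows "L2_inner \<Omega> f h = L2_inner \<Omega> g h"
  unfolding L2_inner_real
proof (rule integral_cong_AE)
  show "AE x in lebesgue_on \<Omega>. f x * h x = g x * h x"
    using assms(1) by (auto simp: L2_eq_def)
qed (use assms in \<open>auto intro!: borel_measurable_times simp: L2_real_iff\<close>)

lemma L2_inner_eq_right:
  fixes f g h :: "'a::euclidean_space \<Rightarrow> real"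
  assumes "L2_eq \<Omega> f g" "f \<in> L2 \<Omega>" "g \<in> L2 \<Omega>" "h \<in> L2 \<Omega>"
  shows "L2_inner \<Omega> h f = L2_inner \<Omega> h g"
  using L2_inner_eq_left[OF assms] by (simp only: L2_inner_commute[of \<Omega> h])

lemma L2_Cauchy_Schwarz:
  fixes f g :: "'a::euclidean_space \<Rightarrow> real"
  assumes f: "f \<in> L2 \<Omega>" and g: "g \<in> L2 \<Omega>"
  shows "\<bar>L2_inner \<Omega> f g\<bar> \<le> L2_norm \<Omega> f * L2_norm \<Omega> g"
proof -
  have quad: "0 \<le> L2_inner \<Omega> f f * t\<^sup>2 + 2 * L2_inner \<Omega> f g * t + L2_inner \<Omega> g g" for t
  proof -
    have "0 \<le> L2_inner \<Omega> (t *\<^sub>F f + g) (t *\<^sub>F f + g)"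
      by (rule L2_inner_nonneg)
    also have "\<dots> = L2_inner \<Omega> f f * t\<^sup>2 + 2 * L2_inner \<Omega> f g * t + L2_inner \<Omega> g g"
      using f g by (simp add: L2_inner_simps L2_inner_commute[of _ g f] power2_eq_square algebra_simps)
    finally show ?thesis .
  qed
  have "(L2_inner \<Omega> f g)\<^sup>2 \<le> L2_inner \<Omega> f f * L2_inner \<Omega> g g"
  proof (cases "L2_inner \<Omega> f f = 0")
    case True
    have "L2_inner \<Omega> f g = 0"
    proof (rule ccontr)
      assume "L2_inner \<Omega> f g \<noteq> 0"
      \<comment> \<open>The quadratic polynomial is linear here, and this argument gives it the value \<open>-1\<close>.\<close>
      with quad[of "- (L2_inner \<Omega> g g + 1) / (2 * L2_inner \<Omega> f g)"] True show False
        by (simp add: field_simps)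
    qed
    then show ?thesis using True by simp
  next
    case False
    then have pos: "0 < L2_inner \<Omega> f f"
      using L2_inner_nonneg[of \<Omega> f] by simp
    \<comment> \<open>the minimiser of the quadratic polynomial\<close>
    from quad[of "- L2_inner \<Omega> f g / L2_inner \<Omega> f f"] pos show ?thesis
      by (simp add: field_simps power2_eq_square)
  qed
  then show ?thesis
    unfolding L2_norm_def by (metis real_sqrt_abs real_sqrt_le_iff real_sqrt_mult)
qed

section \<open>The bilinear form of a bounded operator\<close>

context
  fixes \<Omega> :: "'a::euclidean_space set" and L :: "('a \<Rightarrow> real) \<Rightarrow> ('a \<Rightarrow> real)"
  assumes L: "L2_bounded_linear \<Omega> L"
begin

lemma bounded_linear_L2: "f \<in> L2 \<Omega> \<Longrightarrow> L f \<in> L2 \<Omega>"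
  using L by (simp add: L2_bounded_linear_def)

lemma bounded_linear_L2_bound:
  obtains C where "0 \<le> C" "\<And>f. f \<in> L2 \<Omega> \<Longrightarrow> L2_norm \<Omega> (L f) \<le> C * L2_norm \<Omega> f"
proof -
  from L obtain C where C: "\<forall>f\<in>L2 \<Omega>. L2_norm \<Omega> (L f) \<le> C * L2_norm \<Omega> f"
    unfolding L2_bounded_linear_def by blast
  show thesis
  proof
    show "0 \<le> max C 0" by simp
    show "L2_norm \<Omega> (L f) \<le> max C 0 * L2_norm \<Omega> f" if "f \<in> L2 \<Omega>" for f
      using C that mult_right_mono[of C "max C 0" "L2_norm \<Omega> f"]
      by force
  qed
qed

lemma form_add:
  "\<lbrakk>f \<in> L2 \<Omega>; g \<in> L2 \<Omega>; h \<in> L2 \<Omega>\<rbrakk>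
    \<Longrightarrow> L2_inner \<Omega> (L (f + g)) h = L2_inner \<Omega> (L f) h + L2_inner \<Omega> (L g) h"
  using L L2_inner_eq_left[of \<Omega> "L (f + g)" "L f + L g" h]
  by (simp add: L2_bounded_linear_def L2_inner_add_left)

lemma form_scale:
  "\<lbrakk>f \<in> L2 \<Omega>; h \<in> L2 \<Omega>\<rbrakk> \<Longrightarrow> L2_inner \<Omega> (L (c *\<^sub>F f)) h = c * L2_inner \<Omega> (L f) h"
  using L L2_inner_eq_left[of \<Omega> "L (c *\<^sub>F f)" "c *\<^sub>F L f" h]
  by (simp add: L2_bounded_linear_def L2_inner_scale_left)

lemma form_diff:
  assumes "f \<in> L2 \<Omega>" "g \<in> L2 \<Omega>" "h \<in> L2 \<Omega>"
  shows "L2_inner \<Omega> (L (f - g)) h = L2_inner \<Omega> (L f) h - L2_inner \<Omega> (L g) h"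
proof -
  have "f = (f - g) + g" by auto
  then have "L2_inner \<Omega> (L f) h = L2_inner \<Omega> (L ((f - g) + g)) h" by metis
  then show ?thesis using assms form_add[of "f - g" g h] by simp
qed

text \<open>
  \<open>L\<close> acts on representatives; boundedness makes it compatible with equality almost everywhere,
  since it sends a difference of norm zero to a function of norm zero.
\<close>

lemma form_eq:
  assumes "L2_eq \<Omega> f g" "f \<in> L2 \<Omega>" "g \<in> L2 \<Omega>" "h \<in> L2 \<Omega>"
  shows "L2_inner \<Omega> (L f) h = L2_inner \<Omega> (L g) h"
proof -
  obtain C where C: "\<And>f. f \<in> L2 \<Omega> \<Longrightarrow> L2_norm \<Omega> (L f) \<le> C * L2_norm \<Omega> f"
    using bounded_linear_L2_bound by metis
  have "L2_inner \<Omega> (f - g) (f - g) = 0"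
    using L2_inner_eq_left[of \<Omega> f g "f - g"] assms by (simp add: L2_inner_diff_left)
  then have "L2_norm \<Omega> (L (f - g)) \<le> 0"
    using C[of "f - g"] assms by (simp add: L2_norm_def)
  then have "L2_norm \<Omega> (L (f - g)) = 0"
    using L2_norm_nonneg[of \<Omega> "L (f - g)"] by linarith
  then have "\<bar>L2_inner \<Omega> (L (f - g)) h\<bar> \<le> 0"
    using L2_Cauchy_Schwarz[of "L (f - g)" \<Omega> h] assms bounded_linear_L2[of "f - g"] by simp
  then show ?thesis using assms by (simp add: form_diff)
qed

text \<open>
  The adjoint satisfies \<open>\<parallel>L' g\<parallel>\<^sup>2 = \<langle>L (L' g), g\<rangle>\<close>.  With the boundedness of \<open>L\<close> this
  bounds \<open>L'\<close>, hence makes the supremum in the operator norm of \<open>L \<circ> L'\<close> a genuine one;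
  the same identity then bounds \<open>L'\<close>, and thus the form, by the square root of that norm.
\<close>

lemma form_bound:
  assumes L': "L2_adjoint \<Omega> L L'"
    and f: "f \<in> L2 \<Omega>" and g: "g \<in> L2 \<Omega>"
  shows "(L2_inner \<Omega> (L f) g)\<^sup>2
    \<le> L2_onorm \<Omega> (L \<circ> L') * (L2_inner \<Omega> f f * L2_inner \<Omega> g g)"
proof -
  let ?n = "L2_norm \<Omega> :: ('a \<Rightarrow> real) \<Rightarrow> real" and ?M = "L2_onorm \<Omega> (L \<circ> L')"
  have L'_L2: "L' h \<in> L2 \<Omega>" if "h \<in> L2 \<Omega>" for h
    using L' that by (simp add: L2_adjoint_def)
  have adj: "L2_inner \<Omega> (L a) b = L2_inner \<Omega> a (L' b)" if "a \<in> L2 \<Omega>" "b \<in> L2 \<Omega>" for a b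
    using L' that by (simp add: L2_adjoint_def)
  obtain D where D: "0 \<le> D" "\<And>h. h \<in> L2 \<Omega> \<Longrightarrow> ?n (L h) \<le> D * ?n h"
    using bounded_linear_L2_bound by metis
  have sq: "(?n (L' h))\<^sup>2 \<le> ?n (L (L' h)) * ?n h" if "h \<in> L2 \<Omega>" for h
    using L2_Cauchy_Schwarz[of "L (L' h)" \<Omega> h] adj[of "L' h" h] that L'_L2[OF that]
      bounded_linear_L2[of "L' h"]
    by (simp add: L2_norm_square)
  have nL': "?n (L' h) \<le> D * ?n h" if h: "h \<in> L2 \<Omega>" for h
  proof (cases "?n (L' h) = 0")
    case False
    have "?n (L' h) * ?n (L' h) \<le> ?n (L' h) * (D * ?n h)"
      using sq[OF h] mult_right_mono[OF D(2)[OF L'_L2[OF h]], of "?n h"]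
      by (simp add: power2_eq_square mult_ac)
    then show ?thesis
      using False L2_norm_nonneg[of \<Omega> "L' h"] by (simp add: mult_le_cancel_left)
  qed (use D(1) in simp)
  have nLL': "?n (L (L' h)) \<le> D * D * ?n h" if h: "h \<in> L2 \<Omega>" for h
    using D(2)[OF L'_L2[OF h]] mult_left_mono[OF nL'[OF h] D(1)] by (simp add: mult.assoc)
  have bdd: "bdd_above ((\<lambda>h. ?n ((L \<circ> L') h) / ?n h) ` L2 \<Omega>)"
  proof (rule bdd_aboveI2)
    fix h :: "'a \<Rightarrow> real" assume h: "h \<in> L2 \<Omega>"
    show "?n ((L \<circ> L') h) / ?n h \<le> D * D"
      using nLL'[OF h] D(1) L2_norm_nonneg[of \<Omega> h]
      by (cases "?n h = 0") (auto simp: pos_divide_le_eq order_less_le)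
  qed
  have "?n (L (L' g)) \<le> ?M * ?n g"
  proof (cases "?n g = 0")
    case True
    then show ?thesis using nLL'[OF g] by simp
  next
    case False
    have "?n (L (L' g)) / ?n g \<le> ?M"
      unfolding L2_onorm_def using cSUP_upper[OF g bdd] by simp
    then show ?thesis
      using False L2_norm_nonneg[of \<Omega> g] by (simp add: pos_divide_le_eq order_less_le)
  qed
  then have "(?n (L' g))\<^sup>2 \<le> ?M * (?n g)\<^sup>2"
    using sq[OF g] mult_right_mono[of _ _ "?n g"] by (force simp: power2_eq_square mult.assoc)
  then have "(?n f)\<^sup>2 * (?n (L' g))\<^sup>2 \<le> (?n f)\<^sup>2 * (?M * (?n g)\<^sup>2)"
    by (rule mult_left_mono) simp
  moreover have "(L2_inner \<Omega> (L f) g)\<^sup>2 \<le> (?n f * ?n (L' g))\<^sup>2"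
    unfolding adj[OF f g] abs_le_square_iff[symmetric]
    using L2_Cauchy_Schwarz[OF f L'_L2[OF g]] by simp
  ultimately show ?thesis
    by (simp add: L2_norm_square power_mult_distrib mult_ac)
qed

end

section \<open>The functional \<open>phi\<close>\<close>

lemma L2_integrable_abs:
  fixes f :: "'a::euclidean_space \<Rightarrow> real"
  assumes "\<Omega> \<in> lmeasurable" "f \<in> L2 \<Omega>"
  shows "integrable (lebesgue_on \<Omega>) (\<lambda>x. \<bar>f x\<bar>)"
proof (rule Bochner_Integration.integrable_bound)
  interpret finite_measure "lebesgue_on \<Omega>"
    using assms(1) by (rule finite_measure_lebesgue_on)
  show "integrable (lebesgue_on \<Omega>) (\<lambda>x. 1 + (f x)\<^sup>2)"
    using assms by (auto simp: L2_real_iff)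
  show "(\<lambda>x. \<bar>f x\<bar>) \<in> borel_measurable (lebesgue_on \<Omega>)"
    using assms by (auto simp: L2_real_iff)
  have "\<bar>a\<bar> \<le> 1 + a\<^sup>2" for a :: real
    using sum_squares_bound[of 1 "\<bar>a\<bar>"] by simp
  then show "AE x in lebesgue_on \<Omega>. norm \<bar>f x\<bar> \<le> norm (1 + (f x)\<^sup>2)"
    by (intro AE_I2) (simp add: abs_of_nonneg)
qed

lemma phi_triangle:
  assumes "\<Omega> \<in> lmeasurable" "0 \<le> \<beta>" "f \<in> L2 \<Omega>" "g \<in> L2 \<Omega>"
  shows "phi \<Omega> \<beta> (f + g) \<le> phi \<Omega> \<beta> f + phi \<Omega> \<beta> g"
proof -
  have "(LINT x|lebesgue_on \<Omega>. \<bar>f x + g x\<bar>) \<le> (LINT x|lebesgue_on \<Omega>. \<bar>f x\<bar> + \<bar>g x\<bar>)"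
    using L2_integrable_abs[OF assms(1)] assms(3,4) L2_integrable_abs[OF assms(1) L2_add[OF assms(3,4)]]
    by (intro integral_mono) auto
  then have "(LINT x|lebesgue_on \<Omega>. \<bar>f x + g x\<bar>)
      \<le> (LINT x|lebesgue_on \<Omega>. \<bar>f x\<bar>) + (LINT x|lebesgue_on \<Omega>. \<bar>g x\<bar>)"
    using L2_integrable_abs[OF assms(1)] assms(3,4) by simp
  then show ?thesis
    using mult_left_mono[OF _ assms(2)] by (force simp: phi_def distrib_left[symmetric])
qed

lemma phi_scale: "phi \<Omega> \<beta> (c *\<^sub>F f) = \<bar>c\<bar> * phi \<Omega> \<beta> f"
  by (simp add: phi_def fscale_def abs_mult)

lemma phi_convex:
  assumes "\<Omega> \<in> lmeasurable" "0 \<le> \<beta>" "f \<in> L2 \<Omega>" "g \<in> L2 \<Omega>" "0 \<le> t" "t \<le> 1"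
  shows "phi \<Omega> \<beta> (f + t *\<^sub>F (g - f)) \<le> phi \<Omega> \<beta> f + t * (phi \<Omega> \<beta> g - phi \<Omega> \<beta> f)"
proof -
  have "f + t *\<^sub>F (g - f) = (1 - t) *\<^sub>F f + t *\<^sub>F g"
    by (auto simp: fscale_def algebra_simps)
  then show ?thesis
    using phi_triangle[OF assms(1,2), of "(1 - t) *\<^sub>F f" "t *\<^sub>F g"] assms
    by (simp add: phi_scale algebra_simps)
qed


section \<open>Variational inequality of a proximal step\<close>

text \<open>
  Dividing by \<open>t\<close> and letting \<open>t\<close> tend to zero turns minimality along a segment into a
  statement about the first-order term.
\<close>

lemma first_order_term_nonneg:
  fixes a m :: real
  assumes "\<And>t. \<lbrakk>0 < t; t \<le> 1\<rbrakk> \<Longrightarrow> 0 \<le> t * a + t\<^sup>2 * m"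
  shows "0 \<le> a"
proof (rule ccontr)
  assume a: "\<not> 0 \<le> a"
  \<comment> \<open>small enough for \<open>t * m\<close> to compensate at most half of \<open>a\<close>\<close>
  define t where "t = min 1 (- a / (2 * (\<bar>m\<bar> + 1)))"
  have "0 < 2 * (\<bar>m\<bar> + 1)" by simp
  moreover have "t \<le> - a / (2 * (\<bar>m\<bar> + 1))" by (simp add: t_def)
  ultimately have "t * (2 * (\<bar>m\<bar> + 1)) \<le> - a" by (simp only: pos_le_divide_eq)
  moreover have "0 < t" "t \<le> 1"
    using a by (auto simp: t_def divide_neg_pos)
  ultimately have t: "0 < t" "t \<le> 1" "t * (2 * (\<bar>m\<bar> + 1)) \<le> - a" by blast+
  have "0 \<le> t * (a + t * m)"
    using assms[OF t(1,2)] by (simp add: power2_eq_square algebra_simps)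
  then have "0 \<le> a + t * m"
    using t(1) by (simp add: zero_le_mult_iff)
  moreover have "t * m \<le> t * \<bar>m\<bar>"
    using t(1) by (intro mult_left_mono) auto
  moreover have "0 \<le> t * \<bar>m\<bar>"
    using t(1) by simp
  moreover have "t * \<bar>m\<bar> + t * \<bar>m\<bar> + 2 * t \<le> - a"
    using t(3) by (simp add: algebra_simps)
  ultimately show False
    using t(1) a by linarith
qed

text \<open>
  The quadratic terms are differentiated along the segment from the minimiser \<open>x\<close> to the
  competitor \<open>w\<close>, whereas \<open>J\<close> is only compared with its chord.  Hence the non-smooth functional
  \<open>phi\<close> can be part of \<open>J\<close>, together with the linear coupling terms.
\<close>

lemma proximal_variational_inequality:
  fixes x w z :: "'a::euclidean_space \<Rightarrow> real"
  assumes L2: "x \<in> L2 \<Omega>" "w \<in> L2 \<Omega>" "z \<in> L2 \<Omega>"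
    and minimal: "\<And>y. y \<in> L2 \<Omega> \<Longrightarrow>
      c / 2 * L2_inner \<Omega> x x + J x + 1 / (2 * r) * L2_inner \<Omega> (x - z) (x - z)
        \<le> c / 2 * L2_inner \<Omega> y y + J y + 1 / (2 * r) * L2_inner \<Omega> (y - z) (y - z)"
    and convex: "\<And>t. \<lbrakk>0 \<le> t; t \<le> 1\<rbrakk> \<Longrightarrow> J (x + t *\<^sub>F (w - x)) \<le> J x + t * (J w - J x)"
  shows "0 \<le> J w - J x + c * L2_inner \<Omega> x (w - x) + 1 / r * L2_inner \<Omega> (x - z) (w - x)"
proof -
  define h where "h = w - x"
  have h: "h \<in> L2 \<Omega>" and xz: "x - z \<in> L2 \<Omega>" using L2 by (auto simp: h_def)
  have square: "L2_inner \<Omega> (e + t *\<^sub>F h) (e + t *\<^sub>F h)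
      = L2_inner \<Omega> e e + 2 * t * L2_inner \<Omega> e h + t\<^sup>2 * L2_inner \<Omega> h h"
    if "e \<in> L2 \<Omega>" for e t
    using that h
    by (simp add: L2_inner_simps L2_inner_commute[of \<Omega> h e] power2_eq_square algebra_simps)
  have "0 \<le> J w - J x + c * L2_inner \<Omega> x h + 1 / r * L2_inner \<Omega> (x - z) h"
  proof (rule first_order_term_nonneg[where m = "(c / 2 + 1 / (2 * r)) * L2_inner \<Omega> h h"])
    fix t :: real
    assume t: "0 < t" "t \<le> 1"
    have shift: "(x + t *\<^sub>F h) - z = (x - z) + t *\<^sub>F h" by auto
    have "J (x + t *\<^sub>F h) \<le> J x + t * (J w - J x)"
      unfolding h_def using t by (intro convex) auto
    moreover have "x + t *\<^sub>F h \<in> L2 \<Omega>" using L2 h by simp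
    note minimal[OF this, unfolded shift square[OF L2(1)] square[OF xz]]
    ultimately show "0 \<le> t * (J w - J x + c * L2_inner \<Omega> x h + 1 / r * L2_inner \<Omega> (x - z) h)
        + t\<^sup>2 * ((c / 2 + 1 / (2 * r)) * L2_inner \<Omega> h h)"
      by (simp add: algebra_simps)
  qed
  then show ?thesis by (simp add: h_def)
qed

section \<open>Admissible parameters\<close>

text \<open>
  For \<open>\<sigma> = \<rho> / \<theta>\<close> and after multiplication by \<open>\<theta>\<close>, the difference of the two sides of the last inequality is
  \<open>(1 - \<theta>) ((1 + \<theta> - \<rho>)\<^sup>2 - (1 - \<theta>))\<close>.  The factor \<open>1 - \<theta>\<close> explains why the
  inequality holds for every \<open>\<rho>\<close> if \<open>\<theta> = 1\<close>, and the second factor is nonnegative up to the smaller root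
  \<open>1 + \<theta> - sqrt (1 - \<theta>)\<close>.
\<close>

lemma admissible_parameters:
  fixes \<theta> \<rho> \<sigma> :: real
  assumes "0 < \<theta>" "\<theta> \<le> 1"
    and "\<theta> = 1 \<Longrightarrow> \<rho> = \<sigma> \<and> 0 < \<rho> \<and> \<rho> < 2"
    and "\<theta> < 1 \<Longrightarrow> 0 < \<rho> \<and> \<rho> \<le> 1 + \<theta> - sqrt (1 - \<theta>) \<and> \<sigma> = \<rho> / \<theta>"
  shows "0 < \<rho> \<and> 0 < \<sigma> \<and> \<rho> = \<theta> * \<sigma> \<and> \<rho> \<le> 2 \<and> \<sigma> \<le> 2
    \<and> (1 + \<theta> - \<rho>)\<^sup>2 \<le> (2 - \<rho>) * (2 - \<sigma>)"
proof (cases "\<theta> = 1")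
  case True
  then show ?thesis using assms(3) by (auto simp: power2_eq_square)
next
  case False
  then have \<theta>: "0 < \<theta>" "\<theta> < 1" using assms(1,2) by auto
  define c where "c = sqrt (1 - \<theta>)"
  have c: "0 < c" "c < 1" "c\<^sup>2 = 1 - \<theta>" using \<theta> by (auto simp: c_def)
  have \<rho>: "0 < \<rho>" "\<rho> \<le> 1 + \<theta> - c" and \<sigma>: "\<sigma> = \<rho> / \<theta>"
    using assms(4) \<theta> by (auto simp: c_def)
  have "c\<^sup>2 < c" unfolding power2_eq_square using mult_strict_left_mono[OF c(2,1)] by simp
  then have "\<rho> \<le> 2 * \<theta>" using \<rho> c(3) by linarith
  moreover have "(1 + \<theta> - \<rho>)\<^sup>2 \<le> (2 - \<rho>) * (2 - \<sigma>)"
  proof -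
    have "c\<^sup>2 \<le> (1 + \<theta> - \<rho>)\<^sup>2"
      using \<rho> c by (intro power_mono) auto
    then have "0 \<le> (1 - \<theta>) * ((1 + \<theta> - \<rho>)\<^sup>2 - (1 - \<theta>))"
      using \<theta> c by simp
    also have "\<dots> = \<theta> * ((2 - \<rho>) * (2 - \<sigma>) - (1 + \<theta> - \<rho>)\<^sup>2)"
      using \<theta> \<sigma> by (simp add: field_simps power2_eq_square)
    finally show ?thesis using \<theta> by (simp add: zero_le_mult_iff)
  qed
  moreover have "\<sigma> \<le> 2" if "\<rho> \<le> 2 * \<theta>"
    using that \<theta> by (simp add: \<sigma> pos_divide_le_eq)
  ultimately show ?thesis
    using \<theta> \<rho> \<sigma> by auto
qed

text \<open>
  Used with \<open>A = \<parallel>a\<parallel>\<^sup>2\<close>, \<open>B = \<parallel>b\<parallel>\<^sup>2\<close>, \<open>C = \<langle>L a, b\<rangle>\<close> and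
  \<open>M = \<parallel>L L\<^sup>*\<parallel>\<close>, both for the positivity of \<open>K\<close> and for the remainder of one
  iteration.  The hypothesis on \<open>\<delta>\<close> is the discriminant condition, and the claim follows from
  the inequality between arithmetic and geometric means of \<open>\<alpha> A\<close> and \<open>\<gamma> B\<close>.
\<close>

lemma weighted_form_nonneg:
  fixes A B C M \<alpha> \<gamma> \<delta> :: real
  assumes "0 \<le> A" "0 \<le> B" "C\<^sup>2 \<le> M * (A * B)" "0 \<le> \<alpha>" "0 \<le> \<gamma>" "\<delta>\<^sup>2 * M \<le> 4 * (\<alpha> * \<gamma>)"
  shows "0 \<le> \<alpha> * A + \<gamma> * B - \<delta> * C"
proof -
  have "(\<delta> * C)\<^sup>2 \<le> \<delta>\<^sup>2 * (M * (A * B))"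
    using assms(3) by (simp add: power_mult_distrib mult_left_mono)
  also have "\<dots> \<le> 4 * (\<alpha> * \<gamma>) * (A * B)"
    using mult_right_mono[OF assms(6), of "A * B"] assms(1,2) by (simp add: mult.assoc)
  also have "\<dots> = 4 * ((\<alpha> * A) * (\<gamma> * B))" by simp
  also have "\<dots> \<le> (\<alpha> * A + \<gamma> * B)\<^sup>2"
    using sum_squares_bound[of "\<alpha> * A" "\<gamma> * B"]
    unfolding power2_sum by linarith
  finally have "\<bar>\<delta> * C\<bar> \<le> \<bar>\<alpha> * A + \<gamma> * B\<bar>"
    by (simp add: abs_le_square_iff)
  moreover have "0 \<le> \<alpha> * A + \<gamma> * B" using assms by simp
  ultimately show ?thesis by linarith
qed

section \<open>One iteration\<close>

text \<open>
  This is \<open>(K (a, b), (a, b))\<close>, as \<open>K_normsq_eq_K_form\<close> shows.  It mentions neither the adjoint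
  nor the inverse of \<open>D\<close>, and its single mixed term reflects the symmetry of \<open>K\<close>.
\<close>

definition K_form where
  "K_form \<Omega> L r s \<rho> \<sigma> a b =
     1 / (r * \<rho>) * L2_inner \<Omega> a a + 1 / (s * \<sigma>) * L2_inner \<Omega> b b - 2 / \<sigma> * L2_inner \<Omega> (L a) b"

text \<open>
  The two off-diagonal blocks of \<open>K\<close> have the factors \<open>1 / \<sigma>\<close> and \<open>\<theta> / \<rho>\<close>, which
  \<open>\<rho> = \<theta> \<sigma>\<close> makes equal.
\<close>

lemma K_normsq_eq_K_form:
  fixes a b :: "'a::euclidean_space \<Rightarrow> real"
  assumes L: "L2_bounded_linear \<Omega> L" and L': "L2_adjoint \<Omega> L L'"
    and L2: "a \<in> L2 \<Omega>" "b \<in> L2 \<Omega>"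
    and par: "0 < \<rho>" "0 < \<sigma>" "\<rho> = \<theta> * \<sigma>"
  shows "K_normsq \<Omega> L L' r s \<theta> \<rho> \<sigma> (a, b) = K_form \<Omega> L r s \<rho> \<sigma> a b"
proof -
  have inv: "inv (D_op \<rho> \<sigma>) (a, b) = ((1 / \<rho>) *\<^sub>F a, (1 / \<sigma>) *\<^sub>F b)"
  proof (rule inv_f_eq)
    show "inj (D_op \<rho> \<sigma>)"
      using par(1,2) by (auto simp: inj_def D_op_def fscale_def fun_eq_iff)
    show "D_op \<rho> \<sigma> ((1 / \<rho>) *\<^sub>F a, (1 / \<sigma>) *\<^sub>F b) = (a, b)"
      using par(1,2) by (auto simp: D_op_def fscale_def)
  qed
  have L'_L2: "L' h \<in> L2 \<Omega>" if "h \<in> L2 \<Omega>" for h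
    using L' that by (simp add: L2_adjoint_def)
  have "L2_inner \<Omega> (L a) ((1 / \<sigma>) *\<^sub>F b) = L2_inner \<Omega> a (L' ((1 / \<sigma>) *\<^sub>F b))"
    using L' L2 by (simp add: L2_adjoint_def)
  then have adj: "L2_inner \<Omega> (L' ((1 / \<sigma>) *\<^sub>F b)) a = 1 / \<sigma> * L2_inner \<Omega> (L a) b"
    by (simp only: L2_inner_commute[of \<Omega> "L' ((1 / \<sigma>) *\<^sub>F b)"] L2_inner_scale_right)
  have mem: "L' ((1 / \<sigma>) *\<^sub>F b) \<in> L2 \<Omega>" "L ((1 / \<rho>) *\<^sub>F a) \<in> L2 \<Omega>"
    using L'_L2 bounded_linear_L2[OF L] L2 by auto
  have "\<theta> * t / \<rho> = t / \<sigma>" for t using par by auto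
  then show ?thesis
    using L2 mem
    by (simp add: K_normsq_def K_op_def inv G_op_def W_inner_def K_form_def L2_inner_simps adj
        form_scale[OF L])
qed

text \<open>The updates of the algorithm determine the next iterate only almost everywhere.\<close>

lemma K_form_eq:
  fixes a a' b b' :: "'a::euclidean_space \<Rightarrow> real"
  assumes L: "L2_bounded_linear \<Omega> L"
    and "L2_eq \<Omega> a a'" "L2_eq \<Omega> b b'" "a \<in> L2 \<Omega>" "a' \<in> L2 \<Omega>" "b \<in> L2 \<Omega>" "b' \<in> L2 \<Omega>"
  shows "K_form \<Omega> L r s \<rho> \<sigma> a b = K_form \<Omega> L r s \<rho> \<sigma> a' b'"
proof -
  have "L2_inner \<Omega> a a = L2_inner \<Omega> a' a'" "L2_inner \<Omega> b b = L2_inner \<Omega> b' b'"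
    using assms by (simp_all add: L2_inner_eq_left[of \<Omega> a a'] L2_inner_eq_right[of \<Omega> a a']
        L2_inner_eq_left[of \<Omega> b b'] L2_inner_eq_right[of \<Omega> b b'])
  moreover have "L2_inner \<Omega> (L a) b = L2_inner \<Omega> (L a') b"
    using assms form_eq[OF L] by simp
  moreover have "L2_inner \<Omega> (L a') b = L2_inner \<Omega> (L a') b'"
    using assms by (intro L2_inner_eq_right bounded_linear_L2[OF L]) auto
  ultimately show ?thesis by (simp add: K_form_def)
qed

context
  fixes \<Omega> :: "'a::euclidean_space set" and L L' :: "('a \<Rightarrow> real) \<Rightarrow> ('a \<Rightarrow> real)"
    and r s \<theta> \<rho> \<sigma> :: real
  assumes L: "L2_bounded_linear \<Omega> L" and L': "L2_adjoint \<Omega> L L'"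
    and par: "0 < \<rho>" "0 < \<sigma>" "\<rho> = \<theta> * \<sigma>" "\<theta> \<le> 1"
    and rs: "0 < r" "0 < s" "r * s < 1 / L2_onorm \<Omega> (L \<circ> L')"
begin

text \<open>
  A vanishing operator norm is excluded by the step size condition itself, because then
  \<open>1 / 0 = 0\<close> would bound the positive product \<open>r s\<close>.
\<close>

lemma onorm_bound: "0 < L2_onorm \<Omega> (L \<circ> L')" "L2_onorm \<Omega> (L \<circ> L') \<le> 1 / (r * s)"
proof -
  have "0 < r * s" using rs by simp
  then have "0 < 1 / L2_onorm \<Omega> (L \<circ> L')" using rs(3) by linarith
  then show pos: "0 < L2_onorm \<Omega> (L \<circ> L')" by simp
  show "L2_onorm \<Omega> (L \<circ> L') \<le> 1 / (r * s)"
    using rs pos by (simp add: field_simps)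
qed

text \<open>
  The discriminant condition comes down to \<open>r s \<parallel>L L\<^sup>*\<parallel> \<rho> \<le> \<sigma>\<close>; here \<open>\<theta> \<le> 1\<close>
  enters as \<open>\<rho> \<le> \<sigma>\<close>.
\<close>

lemma K_form_nonneg:
  assumes "a \<in> L2 \<Omega>" "b \<in> L2 \<Omega>"
  shows "0 \<le> K_form \<Omega> L r s \<rho> \<sigma> a b"
  unfolding K_form_def
proof (rule weighted_form_nonneg[OF L2_inner_nonneg L2_inner_nonneg form_bound[OF L L' assms]])
  let ?M = "L2_onorm \<Omega> (L \<circ> L')"
  have "(2 / \<sigma>)\<^sup>2 * ?M \<le> (2 / \<sigma>)\<^sup>2 * (1 / (r * s))"
    by (rule mult_left_mono[OF onorm_bound(2)]) simp
  also have "\<dots> = 4 / (r * s * \<sigma>) * (1 / \<sigma>)"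
    by (simp add: power2_eq_square)
  also have "\<dots> \<le> 4 / (r * s * \<sigma>) * (1 / \<rho>)"
  proof (rule mult_left_mono)
    have "\<rho> \<le> \<sigma>" using par by (simp add: mult_left_le_one_le)
    then show "1 / \<sigma> \<le> 1 / \<rho>" using par(1) by (simp add: frac_le)
  qed (use rs par in simp)
  also have "\<dots> = 4 * (1 / (r * \<rho>) * (1 / (s * \<sigma>)))" by simp
  finally show "(2 / \<sigma>)\<^sup>2 * ?M \<le> 4 * (1 / (r * \<rho>) * (1 / (s * \<sigma>)))" .
qed (use rs par in simp_all)

text \<open>
  This is the identity \<open>\<parallel>z\<parallel>\<^sub>K\<^sup>2 - \<parallel>z - e\<parallel>\<^sub>K\<^sup>2 = 2 (K e, z) - (K e, e)\<close> for
  \<open>z = (x, y)\<close> and \<open>e = D (a, b)\<close>, in which \<open>K e = G (a, b)\<close>.  The terms that pair \<open>a, b\<close>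
  with \<open>x, y\<close> are exactly those that the variational inequalities produce.
\<close>

lemma K_form_decrease:
  assumes L2: "x \<in> L2 \<Omega>" "y \<in> L2 \<Omega>" "a \<in> L2 \<Omega>" "b \<in> L2 \<Omega>"
  shows "1 / 2 * (K_form \<Omega> L r s \<rho> \<sigma> x y - K_form \<Omega> L r s \<rho> \<sigma> (x - \<rho> *\<^sub>F a) (y - \<sigma> *\<^sub>F b))
    = 1 / r * L2_inner \<Omega> x a - \<rho> / 2 * (1 / r * L2_inner \<Omega> a a)
    + 1 / s * L2_inner \<Omega> y b - \<sigma> / 2 * (1 / s * L2_inner \<Omega> b b)
    - L2_inner \<Omega> (L x) b - \<theta> * L2_inner \<Omega> (L a) y + \<rho> * L2_inner \<Omega> (L a) b"
proof -
  have mem: "L x \<in> L2 \<Omega>" "L a \<in> L2 \<Omega>" "L (x - \<rho> *\<^sub>F a) \<in> L2 \<Omega>"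
    using L2 bounded_linear_L2[OF L] by auto
  have \<theta>: "\<theta> = \<rho> / \<sigma>" using par by simp
  show ?thesis
    unfolding K_form_def \<theta>
    using L2 mem par(1,2) rs(1,2)
    by (simp add: L2_inner_simps form_diff[OF L] form_scale[OF L] L2_inner_commute[of \<Omega> a x]
        L2_inner_commute[of \<Omega> b y] field_simps)
qed

text \<open>
  With \<open>(x, y)\<close> the error of the current iterate relative to an arbitrary reference point
  \<open>(u, p)\<close> and \<open>(a, b)\<close> the displacement from predictor to iterate, the predictor's error is
  \<open>(x - a, y - b)\<close>.  Without the squares due to the monotonicity of \<open>F\<close>, the upper bound that
  the variational inequalities give for the left-hand side differs from half the decrease of
  \<open>K_form\<close> by a quadratic form in \<open>a\<close> and \<open>b\<close> alone.
\<close>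

lemma one_iteration:
  assumes L2: "u \<in> L2 \<Omega>" "p \<in> L2 \<Omega>" "uk \<in> L2 \<Omega>" "pk \<in> L2 \<Omega>" "ut \<in> L2 \<Omega>" "pt \<in> L2 \<Omega>"
      "uT \<in> L2 \<Omega>"
    and \<tau>: "0 \<le> \<tau>"
    and par': "\<rho> \<le> 2" "\<sigma> \<le> 2" "(1 + \<theta> - \<rho>)\<^sup>2 \<le> (2 - \<rho>) * (2 - \<sigma>)"
    and primal: "0 \<le> J u - J ut + L2_inner \<Omega> (L u) pk - L2_inner \<Omega> (L ut) pk
      + \<tau> * L2_inner \<Omega> ut (u - ut) + 1 / r * L2_inner \<Omega> (ut - uk) (u - ut)"
    and dual: "0 \<le> L2_inner \<Omega> p uT - L2_inner \<Omega> pt uT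
      - L2_inner \<Omega> (L (ut + \<theta> *\<^sub>F (ut - uk))) p + L2_inner \<Omega> (L (ut + \<theta> *\<^sub>F (ut - uk))) pt
      + L2_inner \<Omega> pt (p - pt) + 1 / s * L2_inner \<Omega> (pt - pk) (p - pt)"
  shows "J ut - J u + W_inner \<Omega> ((ut, pt) - (u, p)) (F_op L L' uT \<tau> (u, p))
    \<le> 1 / 2 * (K_form \<Omega> L r s \<rho> \<sigma> (uk - u) (pk - p)
        - K_form \<Omega> L r s \<rho> \<sigma> (uk - \<rho> *\<^sub>F (uk - ut) - u) (pk - \<sigma> *\<^sub>F (pk - pt) - p))"
proof -
  define x y a b where "x = uk - u" and "y = pk - p" and "a = uk - ut" and "b = pk - pt"
  have mem: "x \<in> L2 \<Omega>" "y \<in> L2 \<Omega>" "a \<in> L2 \<Omega>" "b \<in> L2 \<Omega>"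
    using L2 by (auto simp: x_def y_def a_def b_def)
  have memL: "L u \<in> L2 \<Omega>" "L x \<in> L2 \<Omega>" "L a \<in> L2 \<Omega>" "L' p \<in> L2 \<Omega>"
    using mem L2 bounded_linear_L2[OF L] L' by (auto simp: L2_adjoint_def)
  have subst: "uk = u + x" "pk = p + y" "ut = u + (x - a)" "pt = p + (y - b)"
    by (auto simp: x_def y_def a_def b_def)
  note expand = L2_inner_simps form_add[OF L] form_diff[OF L] form_scale[OF L]
  have P: "J ut - J u \<le> - L2_inner \<Omega> (L (x - a)) (p + y)
      - \<tau> * L2_inner \<Omega> u (x - a) - \<tau> * L2_inner \<Omega> (x - a) (x - a)
      + 1 / r * (L2_inner \<Omega> x a - L2_inner \<Omega> a a)"
  proof -
    have d: "u - ut = a - x" "ut - uk = - a" by (auto simp: x_def a_def)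
    have e1: "L2_inner \<Omega> ut (a - x) = - L2_inner \<Omega> u (x - a) - L2_inner \<Omega> (x - a) (x - a)"
      unfolding subst using mem L2 by (simp add: expand)
    have e2: "L2_inner \<Omega> (- a) (a - x) = L2_inner \<Omega> x a - L2_inner \<Omega> a a"
      using mem by (simp add: expand L2_inner_commute)
    have e3: "L2_inner \<Omega> (L ut) pk = L2_inner \<Omega> (L u) pk + L2_inner \<Omega> (L (x - a)) (p + y)"
      unfolding subst using mem L2 by (simp add: form_add[OF L])
    show ?thesis
      using primal[unfolded d e1 e2 e3] by (simp add: algebra_simps)
  qed
  have D: "L2_inner \<Omega> (y - b) uT \<le> L2_inner \<Omega> (L (u + (x - a) - \<theta> *\<^sub>F a)) (y - b)
      - L2_inner \<Omega> p (y - b) - L2_inner \<Omega> (y - b) (y - b)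
      + 1 / s * (L2_inner \<Omega> y b - L2_inner \<Omega> b b)"
  proof -
    have d: "p - pt = b - y" "pt - pk = - b" by (auto simp: y_def b_def)
    have bar: "ut + \<theta> *\<^sub>F (ut - uk) = u + (x - a) - \<theta> *\<^sub>F a"
      by (auto simp: x_def a_def fscale_def algebra_simps)
    have e1: "L2_inner \<Omega> pt (b - y) = - L2_inner \<Omega> p (y - b) - L2_inner \<Omega> (y - b) (y - b)"
      unfolding subst using mem L2 by (simp add: expand)
    have e2: "L2_inner \<Omega> (- b) (b - y) = L2_inner \<Omega> y b - L2_inner \<Omega> b b"
      using mem by (simp add: expand L2_inner_commute)
    have e3: "L2_inner \<Omega> pt uT = L2_inner \<Omega> p uT + L2_inner \<Omega> (y - b) uT"
      unfolding subst using mem L2 by (simp add: expand)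
    have e4: "L2_inner \<Omega> (L (u + (x - a) - \<theta> *\<^sub>F a)) pt
        = L2_inner \<Omega> (L (u + (x - a) - \<theta> *\<^sub>F a)) p + L2_inner \<Omega> (L (u + (x - a) - \<theta> *\<^sub>F a)) (y - b)"
      unfolding subst
      using mem L2 bounded_linear_L2[OF L, of "u + (x - a) - \<theta> *\<^sub>F a"] by (intro L2_inner_add_right) auto
    show ?thesis
      using dual[unfolded d bar e1 e2 e3 e4] by (simp add: algebra_simps)
  qed
  have W: "W_inner \<Omega> ((ut, pt) - (u, p)) (F_op L L' uT \<tau> (u, p))
    = \<tau> * L2_inner \<Omega> u (x - a) + L2_inner \<Omega> (L (x - a)) p
      + L2_inner \<Omega> p (y - b) - L2_inner \<Omega> (L u) (y - b) + L2_inner \<Omega> (y - b) uT"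
  proof -
    have d: "(ut, pt) - (u, p) = (x - a, y - b)" by (auto simp: x_def y_def a_def b_def)
    have "L2_inner \<Omega> (x - a) (L' p) = L2_inner \<Omega> (L (x - a)) p"
      using L' mem L2 by (simp add: L2_adjoint_def)
    moreover have "x - a \<in> L2 \<Omega>" "y - b \<in> L2 \<Omega>" using mem by auto
    ultimately show ?thesis
      unfolding d using L2 memL
      by (simp add: W_inner_def F_op_def L2_inner_add_right[of _ _ _ "x - a"]
          L2_inner_add_right[of _ _ _ "y - b"] L2_inner_diff_right[of _ _ _ "y - b"]
          L2_inner_scale_right L2_inner_commute[of \<Omega> "x - a" u]
          L2_inner_commute[of \<Omega> "y - b" p] L2_inner_commute[of \<Omega> "y - b" "L u"])
  qed
  \<comment> \<open>the form of \<open>G\<close> minus half that of \<open>D G\<close>, at \<open>(a, b)\<close>\<close>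
  have remainder: "0 \<le> (1 - \<rho> / 2) * (1 / r) * L2_inner \<Omega> a a + (1 - \<sigma> / 2) * (1 / s) * L2_inner \<Omega> b b
      - (1 + \<theta> - \<rho>) * L2_inner \<Omega> (L a) b"
  proof (rule weighted_form_nonneg[OF L2_inner_nonneg L2_inner_nonneg form_bound[OF L L' mem(3,4)]])
    let ?M = "L2_onorm \<Omega> (L \<circ> L')"
    have "(1 + \<theta> - \<rho>)\<^sup>2 * ?M \<le> ((2 - \<rho>) * (2 - \<sigma>)) * (1 / (r * s))"
      using par' onorm_bound by (intro mult_mono) auto
    also have "\<dots> = 4 * ((1 - \<rho> / 2) * (1 / r) * ((1 - \<sigma> / 2) * (1 / s)))"
      using rs by (simp add: field_simps)
    finally show "(1 + \<theta> - \<rho>)\<^sup>2 * ?M \<le> 4 * ((1 - \<rho> / 2) * (1 / r) * ((1 - \<sigma> / 2) * (1 / s)))" .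
  qed (use par' rs in simp_all)
  \<comment> \<open>monotonicity of \<open>F\<close>: these squares separate \<open>F\<close> at the predictor from \<open>F\<close> at \<open>(u, p)\<close>\<close>
  have "0 \<le> \<tau> * L2_inner \<Omega> (x - a) (x - a)" "0 \<le> L2_inner \<Omega> (y - b) (y - b)"
    using \<tau> L2_inner_nonneg[of \<Omega> "x - a"] L2_inner_nonneg[of \<Omega> "y - b"] by auto
  with P D W have "J ut - J u + W_inner \<Omega> ((ut, pt) - (u, p)) (F_op L L' uT \<tau> (u, p))
    \<le> (- L2_inner \<Omega> (L (x - a)) (p + y) + L2_inner \<Omega> (L (x - a)) p
        - L2_inner \<Omega> (L u) (y - b) + L2_inner \<Omega> (L (u + (x - a) - \<theta> *\<^sub>F a)) (y - b))
      + 1 / r * (L2_inner \<Omega> x a - L2_inner \<Omega> a a) + 1 / s * (L2_inner \<Omega> y b - L2_inner \<Omega> b b)"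
    by linarith
  also have "- L2_inner \<Omega> (L (x - a)) (p + y) + L2_inner \<Omega> (L (x - a)) p
        - L2_inner \<Omega> (L u) (y - b) + L2_inner \<Omega> (L (u + (x - a) - \<theta> *\<^sub>F a)) (y - b)
      = - L2_inner \<Omega> (L x) b - \<theta> * L2_inner \<Omega> (L a) y + (1 + \<theta>) * L2_inner \<Omega> (L a) b"
    using mem L2 memL by (simp add: form_add[OF L] form_diff[OF L] form_scale[OF L] L2_inner_add_right
        L2_inner_diff_right algebra_simps)
  finally have "J ut - J u + W_inner \<Omega> ((ut, pt) - (u, p)) (F_op L L' uT \<tau> (u, p))
    \<le> 1 / 2 * (K_form \<Omega> L r s \<rho> \<sigma> x y - K_form \<Omega> L r s \<rho> \<sigma> (x - \<rho> *\<^sub>F a) (y - \<sigma> *\<^sub>F b))"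
    unfolding K_form_decrease[OF mem] using remainder by (simp add: algebra_simps)
  moreover have "uk - \<rho> *\<^sub>F (uk - ut) - u = x - \<rho> *\<^sub>F a" "pk - \<sigma> *\<^sub>F (pk - pt) - p = y - \<sigma> *\<^sub>F b"
    by (auto simp: x_def y_def a_def b_def)
  ultimately show ?thesis by (simp only: x_def y_def)
qed

end

section \<open>The steps of the algorithm as variational inequalities\<close>

lemma lebesgue_integral_square: "(LINT x|lebesgue_on \<Omega>. \<bar>f x\<bar>\<^sup>2) = L2_inner \<Omega> f f"
  for f :: "'a::euclidean_space \<Rightarrow> real"
  by (simp add: L2_inner_real power2_eq_square)

lemma primal_step:
  fixes uk pk ut w :: "'a::euclidean_space \<Rightarrow> real"
  assumes \<Omega>: "\<Omega> \<in> lmeasurable" and \<beta>: "0 \<le> \<beta>" and L: "L2_bounded_linear \<Omega> L"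
    and L2: "uk \<in> L2 \<Omega>" "pk \<in> L2 \<Omega>" "w \<in> L2 \<Omega>"
    and step: "is_arg_min
          (\<lambda>w. g_fun \<Omega> \<tau> \<beta> w + (LINT x|lebesgue_on \<Omega>. pk x * L w x)
                 + 1 / (2 * r) * (L2_norm \<Omega> (w - uk))\<^sup>2)
          (\<lambda>w. w \<in> L2 \<Omega>) ut"
  shows "0 \<le> phi \<Omega> \<beta> w - phi \<Omega> \<beta> ut + L2_inner \<Omega> (L w) pk - L2_inner \<Omega> (L ut) pk
      + \<tau> * L2_inner \<Omega> ut (w - ut) + 1 / r * L2_inner \<Omega> (ut - uk) (w - ut)"
proof -
  define J where "J y = phi \<Omega> \<beta> y + L2_inner \<Omega> (L y) pk" for y
  have ut: "ut \<in> L2 \<Omega>" using step by (simp add: is_arg_min_def)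
  have objective: "g_fun \<Omega> \<tau> \<beta> y + (LINT x|lebesgue_on \<Omega>. pk x * L y x)
      + 1 / (2 * r) * (L2_norm \<Omega> (y - uk))\<^sup>2
    = \<tau> / 2 * L2_inner \<Omega> y y + J y + 1 / (2 * r) * L2_inner \<Omega> (y - uk) (y - uk)" for y
    by (simp only: g_fun_def lebesgue_integral_square L2_norm_square J_def L2_inner_real mult.commute
        add.assoc)
  have "0 \<le> J w - J ut + \<tau> * L2_inner \<Omega> ut (w - ut) + 1 / r * L2_inner \<Omega> (ut - uk) (w - ut)"
  proof (rule proximal_variational_inequality[OF ut L2(3,1)])
    show "\<tau> / 2 * L2_inner \<Omega> ut ut + J ut + 1 / (2 * r) * L2_inner \<Omega> (ut - uk) (ut - uk)
        \<le> \<tau> / 2 * L2_inner \<Omega> y y + J y + 1 / (2 * r) * L2_inner \<Omega> (y - uk) (y - uk)"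
      if "y \<in> L2 \<Omega>" for y
      using step that unfolding is_arg_min_def objective by (meson not_less)
    show "J (ut + t *\<^sub>F (w - ut)) \<le> J ut + t * (J w - J ut)" if "0 \<le> t" "t \<le> 1" for t
      using phi_convex[OF \<Omega> \<beta> ut L2(3) that] ut L2
      by (simp add: J_def form_add[OF L] form_diff[OF L] form_scale[OF L] algebra_simps)
  qed
  then show ?thesis by (simp add: J_def)
qed

lemma dual_step:
  fixes ub pk pt q :: "'a::euclidean_space \<Rightarrow> real"
  assumes L: "L2_bounded_linear \<Omega> L"
    and L2: "ub \<in> L2 \<Omega>" "pk \<in> L2 \<Omega>" "q \<in> L2 \<Omega>" "uT \<in> L2 \<Omega>"
    and step: "is_arg_max
          (\<lambda>q. (LINT x|lebesgue_on \<Omega>. q x * L ub x) - f_conj \<Omega> uT q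
                 - 1 / (2 * s) * (L2_norm \<Omega> (q - pk))\<^sup>2)
          (\<lambda>q. q \<in> L2 \<Omega>) pt"
  shows "0 \<le> L2_inner \<Omega> q uT - L2_inner \<Omega> pt uT - L2_inner \<Omega> (L ub) q + L2_inner \<Omega> (L ub) pt
      + L2_inner \<Omega> pt (q - pt) + 1 / s * L2_inner \<Omega> (pt - pk) (q - pt)"
proof -
  define J where "J y = L2_inner \<Omega> y uT - L2_inner \<Omega> y (L ub)" for y
  have pt: "pt \<in> L2 \<Omega>" using step by (simp add: is_arg_max_def)
  have Lub: "L ub \<in> L2 \<Omega>" using L L2(1) by (rule bounded_linear_L2)
  have objective: "(LINT x|lebesgue_on \<Omega>. y x * L ub x) - f_conj \<Omega> uT y
      - 1 / (2 * s) * (L2_norm \<Omega> (y - pk))\<^sup>2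
    = - (1 / 2 * L2_inner \<Omega> y y + J y + 1 / (2 * s) * L2_inner \<Omega> (y - pk) (y - pk))" for y
    unfolding f_conj_def lebesgue_integral_square L2_norm_square J_def L2_inner_real by simp
  have "0 \<le> J q - J pt + 1 * L2_inner \<Omega> pt (q - pt) + 1 / s * L2_inner \<Omega> (pt - pk) (q - pt)"
  proof (rule proximal_variational_inequality[OF pt L2(3,2)])
    show "1 / 2 * L2_inner \<Omega> pt pt + J pt + 1 / (2 * s) * L2_inner \<Omega> (pt - pk) (pt - pk)
        \<le> 1 / 2 * L2_inner \<Omega> y y + J y + 1 / (2 * s) * L2_inner \<Omega> (y - pk) (y - pk)"
      if "y \<in> L2 \<Omega>" for y
      using step that unfolding is_arg_max_def objective by (meson not_less neg_less_iff_less)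
    show "J (pt + t *\<^sub>F (q - pt)) \<le> J pt + t * (J q - J pt)" for t
      using pt L2 Lub by (simp add: J_def L2_inner_simps algebra_simps)
  qed
  then show ?thesis by (simp add: J_def L2_inner_commute[of \<Omega> _ "L ub"])
qed

section \<open>Ergodic means\<close>

lemma L2_sum:
  fixes a :: "nat \<Rightarrow> 'a::euclidean_space \<Rightarrow> real"
  assumes "\<And>k. a k \<in> L2 \<Omega>"
  shows "(\<Sum>k=0..K. a k) \<in> L2 \<Omega>"
  using assms by (induction K) auto

lemma L2_inner_ergodic_mean:
  fixes a :: "nat \<Rightarrow> 'a::euclidean_space \<Rightarrow> real"
  assumes "\<And>k. a k \<in> L2 \<Omega>" "h \<in> L2 \<Omega>"
  shows "L2_inner \<Omega> (ergodic_mean a K) h = 1 / (real K + 1) * (\<Sum>k=0..K. L2_inner \<Omega> (a k) h)"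
proof -
  have "L2_inner \<Omega> (\<Sum>k=0..K. a k) h = (\<Sum>k=0..K. L2_inner \<Omega> (a k) h)"
    using assms by (induction K) (auto simp: L2_inner_add_left L2_sum)
  then show ?thesis by (simp add: ergodic_mean_def L2_inner_scale_left)
qed

lemma phi_ergodic_mean:
  assumes "\<Omega> \<in> lmeasurable" "0 \<le> \<beta>" "\<And>k. a k \<in> L2 \<Omega>"
  shows "phi \<Omega> \<beta> (ergodic_mean a K) \<le> 1 / (real K + 1) * (\<Sum>k=0..K. phi \<Omega> \<beta> (a k))"
proof -
  have "phi \<Omega> \<beta> (\<Sum>k=0..K. a k) \<le> (\<Sum>k=0..K. phi \<Omega> \<beta> (a k))"
  proof (induction K)
    case (Suc K)
    then show ?case
      using phi_triangle[OF assms(1,2) L2_sum[of a \<Omega> K, OF assms(3)] assms(3)[of "Suc K"]]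
      unfolding sum.atLeast0_atMost_Suc by linarith
  qed simp
  then have "\<bar>1 / (real K + 1)\<bar> * phi \<Omega> \<beta> (\<Sum>k=0..K. a k)
      \<le> 1 / (real K + 1) * (\<Sum>k=0..K. phi \<Omega> \<beta> (a k))"
    by (simp add: divide_right_mono)
  then show ?thesis by (simp only: ergodic_mean_def phi_scale)
qed

lemma ergodic_mean_diff_inner:
  fixes a :: "nat \<Rightarrow> 'a::euclidean_space \<Rightarrow> real"
  assumes "\<And>k. a k \<in> L2 \<Omega>" "b \<in> L2 \<Omega>" "h \<in> L2 \<Omega>"
  shows "L2_inner \<Omega> (ergodic_mean a K - b) h
    = 1 / (real K + 1) * (\<Sum>k=0..K. L2_inner \<Omega> (a k - b) h)"
proof -
  have "ergodic_mean a K \<in> L2 \<Omega>"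
    using assms(1) by (simp add: ergodic_mean_def L2_sum)
  then show ?thesis
    using assms by (simp add: L2_inner_diff_left L2_inner_ergodic_mean sum_subtractf field_simps)
qed

lemma sum_le_of_decrease:
  fixes e n :: "nat \<Rightarrow> real"
  assumes "\<And>k. e k \<le> 1 / 2 * (n k - n (Suc k))"
  shows "(\<Sum>k=0..K. e k) \<le> 1 / 2 * (n 0 - n (Suc K))"
proof (induction K)
  case (Suc K)
  then show ?case using assms[of "Suc K"] by simp
qed (use assms[of 0] in simp)

text \<open>
  The reference point \<open>(uw, pw)\<close> is arbitrary because the variational inequalities hold against
  every competitor.
\<close>

lemma ergodic_rate:
  fixes \<Omega> :: "'a::euclidean_space set"
  assumes \<Omega>: "\<Omega> \<in> lmeasurable" and \<tau>: "0 \<le> \<tau>" and \<beta>: "0 \<le> \<beta>"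
    and uT: "uT \<in> L2 \<Omega>"
    and L: "L2_bounded_linear \<Omega> L" and L': "L2_adjoint \<Omega> L L'"
    and \<theta>: "0 < \<theta>" "\<theta> \<le> 1"
    and rs: "0 < r" "0 < s" "r * s < 1 / L2_onorm \<Omega> (L \<circ> L')"
    and theta_one: "\<theta> = 1 \<Longrightarrow> \<rho> = \<sigma> \<and> 0 < \<rho> \<and> \<rho> < 2"
    and theta_less_one: "\<theta> < 1 \<Longrightarrow> 0 < \<rho> \<and> \<rho> \<le> 1 + \<theta> - sqrt (1 - \<theta>) \<and> \<sigma> = \<rho> / \<theta>"
    and iterates: "gpd_iterates \<Omega> L uT \<tau> \<beta> r s \<theta> \<rho> \<sigma> u p ut pt"
    and w: "uw \<in> L2 \<Omega>" "pw \<in> L2 \<Omega>"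
  shows "phi \<Omega> \<beta> (ergodic_mean ut K) - phi \<Omega> \<beta> uw
           + W_inner \<Omega> ((ergodic_mean ut K, ergodic_mean pt K) - (uw, pw)) (F_op L L' uT \<tau> (uw, pw))
         \<le> 1 / (2 * (real K + 1)) * K_normsq \<Omega> L L' r s \<theta> \<rho> \<sigma> ((u 0, p 0) - (uw, pw))"
proof -
  have par: "0 < \<rho>" "0 < \<sigma>" "\<rho> = \<theta> * \<sigma>" "\<rho> \<le> 2" "\<sigma> \<le> 2" "(1 + \<theta> - \<rho>)\<^sup>2 \<le> (2 - \<rho>) * (2 - \<sigma>)"
    using admissible_parameters[OF \<theta> theta_one theta_less_one] by auto
  note it = iterates[unfolded gpd_iterates_def]
  have u: "u k \<in> L2 \<Omega>" and p: "p k \<in> L2 \<Omega>" for k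
    using it by (cases k; blast)+
  have ut: "ut k \<in> L2 \<Omega>" and pt: "pt k \<in> L2 \<Omega>" for k
    using it unfolding is_arg_min_def is_arg_max_def by blast+
  define gap where "gap x y = phi \<Omega> \<beta> x - phi \<Omega> \<beta> uw
    + W_inner \<Omega> ((x, y) - (uw, pw)) (F_op L L' uT \<tau> (uw, pw))" for x y
  define n where "n k = K_form \<Omega> L r s \<rho> \<sigma> (u k - uw) (p k - pw)" for k
  have "gap (ut k) (pt k) \<le> 1 / 2 * (n k - n (Suc k))" for k
  proof -
    have "gap (ut k) (pt k) \<le> 1 / 2 * (n k
        - K_form \<Omega> L r s \<rho> \<sigma> (u k - \<rho> *\<^sub>F (u k - ut k) - uw) (p k - \<sigma> *\<^sub>F (p k - pt k) - pw))"
      unfolding gap_def n_def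
    proof (rule one_iteration[OF L L' par(1-3) \<theta>(2) rs w u p ut pt uT \<tau> par(4-6)])
      show "0 \<le> phi \<Omega> \<beta> uw - phi \<Omega> \<beta> (ut k) + L2_inner \<Omega> (L uw) (p k) - L2_inner \<Omega> (L (ut k)) (p k)
          + \<tau> * L2_inner \<Omega> (ut k) (uw - ut k) + 1 / r * L2_inner \<Omega> (ut k - u k) (uw - ut k)"
        using it by (intro primal_step[OF \<Omega> \<beta> L u p w(1)]) blast
      have "ut k + \<theta> *\<^sub>F (ut k - u k) \<in> L2 \<Omega>" using u ut by simp
      then show "0 \<le> L2_inner \<Omega> pw uT - L2_inner \<Omega> (pt k) uT
          - L2_inner \<Omega> (L (ut k + \<theta> *\<^sub>F (ut k - u k))) pw
          + L2_inner \<Omega> (L (ut k + \<theta> *\<^sub>F (ut k - u k))) (pt k)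
          + L2_inner \<Omega> (pt k) (pw - pt k) + 1 / s * L2_inner \<Omega> (pt k - p k) (pw - pt k)"
        using it by (intro dual_step[OF L _ p w(2) uT]) blast+
    qed
    moreover have "n (Suc k)
        = K_form \<Omega> L r s \<rho> \<sigma> (u k - \<rho> *\<^sub>F (u k - ut k) - uw) (p k - \<sigma> *\<^sub>F (p k - pt k) - pw)"
      unfolding n_def
    proof (rule K_form_eq[OF L])
      have "L2_eq \<Omega> (u (Suc k)) (u k - \<rho> *\<^sub>F (u k - ut k))"
        and "L2_eq \<Omega> (p (Suc k)) (p k - \<sigma> *\<^sub>F (p k - pt k))"
        using it by blast+
      then show "L2_eq \<Omega> (u (Suc k) - uw) (u k - \<rho> *\<^sub>F (u k - ut k) - uw)"
        and "L2_eq \<Omega> (p (Suc k) - pw) (p k - \<sigma> *\<^sub>F (p k - pt k) - pw)"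
        unfolding L2_eq_def by (auto elim: eventually_mono)
    qed (use u p ut pt w in auto)
    ultimately show ?thesis by simp
  qed
  then have sum: "(\<Sum>k=0..K. gap (ut k) (pt k)) \<le> 1 / 2 * (n 0 - n (Suc K))"
    by (rule sum_le_of_decrease)
  have "0 \<le> n (Suc K)"
    unfolding n_def using u p w by (intro K_form_nonneg[OF L L' par(1-3) \<theta>(2) rs]) auto
  then have "1 / 2 * (n 0 - n (Suc K)) \<le> 1 / 2 * n 0" by simp
  with sum have sum': "(\<Sum>k=0..K. gap (ut k) (pt k)) \<le> 1 / 2 * n 0" by (rule order_trans)
  have F: "\<tau> *\<^sub>F uw + L' pw \<in> L2 \<Omega>" "pw - L uw + uT \<in> L2 \<Omega>"
    using w uT bounded_linear_L2[OF L] L' by (auto simp: L2_adjoint_def)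
  have "gap (ergodic_mean ut K) (ergodic_mean pt K)
      \<le> 1 / (real K + 1) * (\<Sum>k=0..K. gap (ut k) (pt k))"
  proof -
    have "1 / (real K + 1) * (\<Sum>k=0..K. gap (ut k) (pt k))
        = 1 / (real K + 1) * (\<Sum>k=0..K. phi \<Omega> \<beta> (ut k)) - phi \<Omega> \<beta> uw
          + 1 / (real K + 1) * (\<Sum>k=0..K. L2_inner \<Omega> (ut k - uw) (\<tau> *\<^sub>F uw + L' pw))
          + 1 / (real K + 1) * (\<Sum>k=0..K. L2_inner \<Omega> (pt k - pw) (pw - L uw + uT))"
    proof -
      have "(\<Sum>k=0..K. gap (ut k) (pt k))
          = (\<Sum>k=0..K. phi \<Omega> \<beta> (ut k)) - (real K + 1) * phi \<Omega> \<beta> uw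
            + (\<Sum>k=0..K. L2_inner \<Omega> (ut k - uw) (\<tau> *\<^sub>F uw + L' pw))
            + (\<Sum>k=0..K. L2_inner \<Omega> (pt k - pw) (pw - L uw + uT))"
        by (simp add: gap_def W_inner_def F_op_def sum.distrib sum_subtractf algebra_simps)
      moreover have "1 / (real K + 1) * ((real K + 1) * phi \<Omega> \<beta> uw) = phi \<Omega> \<beta> uw"
        by simp
      ultimately show ?thesis
        by (simp only: distrib_left right_diff_distrib)
    qed
    moreover have "gap (ergodic_mean ut K) (ergodic_mean pt K)
        = phi \<Omega> \<beta> (ergodic_mean ut K) - phi \<Omega> \<beta> uw
          + 1 / (real K + 1) * (\<Sum>k=0..K. L2_inner \<Omega> (ut k - uw) (\<tau> *\<^sub>F uw + L' pw))
          + 1 / (real K + 1) * (\<Sum>k=0..K. L2_inner \<Omega> (pt k - pw) (pw - L uw + uT))"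
      using ergodic_mean_diff_inner[of ut \<Omega> uw _ K, OF ut w(1) F(1)]
        ergodic_mean_diff_inner[of pt \<Omega> pw _ K, OF pt w(2) F(2)]
      by (simp add: gap_def W_inner_def F_op_def)
    ultimately show ?thesis
      using phi_ergodic_mean[of \<Omega> \<beta> ut K, OF \<Omega> \<beta> ut] by linarith
  qed
  also have "\<dots> \<le> 1 / (real K + 1) * (1 / 2 * n 0)"
    by (rule mult_left_mono[OF sum']) simp
  also have "\<dots> = 1 / (2 * (real K + 1)) * K_normsq \<Omega> L L' r s \<theta> \<rho> \<sigma> ((u 0, p 0) - (uw, pw))"
    using K_normsq_eq_K_form[OF L L' _ _ par(1-3), of "u 0 - uw" "p 0 - pw" r s] u p w
    by (simp add: n_def)
  finally show ?thesis by (simp add: gap_def)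
qed

theorem theorem4p4:
  fixes \<Omega> :: "(real^'n) set" and v :: "real^'n"
    and T d \<tau> \<beta> r s \<theta> \<rho> \<sigma> :: real
    and uT us ps :: "real^'n \<Rightarrow> real"
    and L L' :: "(real^'n \<Rightarrow> real) \<Rightarrow> (real^'n \<Rightarrow> real)"
    and u p ut pt :: "nat \<Rightarrow> real^'n \<Rightarrow> real"
    and K :: nat
  assumes domain: "open \<Omega>" "connected \<Omega>" "\<Omega> \<noteq> {}" "bounded \<Omega>"
    and constants: "0 < T" "0 < d" "0 < \<tau>" "0 < \<beta>"
    and uT: "uT \<in> L2 \<Omega>"
    and L: "L2_bounded_linear \<Omega> L" "solution_operator \<Omega> T d v L"
    and L': "L2_adjoint \<Omega> L L'"
    and \<theta>: "0 < \<theta>" "\<theta> \<le> 1"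
    and rs: "0 < r" "0 < s" "r * s < 1 / L2_onorm \<Omega> (L \<circ> L')"
    and theta_one: "\<theta> = 1 \<Longrightarrow> \<rho> = \<sigma> \<and> 0 < \<rho> \<and> \<rho> < 2"
    and theta_less_one: "\<theta> < 1 \<Longrightarrow> 0 < \<rho> \<and> \<rho> \<le> 1 + \<theta> - sqrt (1 - \<theta>) \<and> \<sigma> = \<rho> / \<theta>"
    and iterates: "gpd_iterates \<Omega> L uT \<tau> \<beta> r s \<theta> \<rho> \<sigma> u p ut pt"
    and saddle: "saddle_point \<Omega> L uT \<tau> \<beta> us ps"
  shows "phi \<Omega> \<beta> (ergodic_mean ut K) - phi \<Omega> \<beta> us
           + W_inner \<Omega> ((ergodic_mean ut K, ergodic_mean pt K) - (us, ps)) (F_op L L' uT \<tau> (us, ps))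
         \<le> 1 / (2 * (real K + 1)) * K_normsq \<Omega> L L' r s \<theta> \<rho> \<sigma> ((u 0, p 0) - (us, ps))"
proof -
  have "\<Omega> \<in> lmeasurable"
    using domain by (simp add: lmeasurable_open)
  moreover have "us \<in> L2 \<Omega>" "ps \<in> L2 \<Omega>"
    using saddle by (simp_all add: saddle_point_def Let_def)
  ultimately show ?thesis
    using constants
    by (intro ergodic_rate[OF _ _ _ uT L(1) L' \<theta> rs theta_one theta_less_one iterates]) auto
qed

end
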